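(* Let $(X,d)$ be a quasi-metric space with base point $x_0$. Then the dual cone $\mathcal{F}_a(X)^*$ of the semi-Lipschitz free space $\mathcal{F}_a(X)$ is isometrically isomorphic to $(\mathrm{SLip}_0(X),\|\cdot|_S)$.
   Context: A quasi-metric space is a pair $(X,d)$ with $X\neq\emptyset$ and $d:X\times X\to[0,\infty)$ satisfying $d(x,y)\le d(x,z)+d(z,y)$ for all $x,y,z$, and either ($x=y\iff d(x,y)=0$) (quasi-metric) or ($x=y\iff d(x,y)=d(y,x)=0$) (quasi-hemi-metric); both variants are allowed. Semi-Lipschitz functions: $f:X\to\mathbb{R}$ is semi-Lipschitz if there is $L>0$ with $f(x)-f(y)\le L\,d(y,x)$ for all $x,y\in X$; $\|f|_S$ is the infimum of all such $L>0$. $\mathrm{SLip}_0(X)$ is the set of semi-Lipschitz functions with $f(x_0)=0$; it is a cone (closed under addition and multiplication by scalars $\ge 0$). A mapping between cones is linear if it is additive and commutes with multiplication by nonnegative scalars. Dual of $\mathrm{SLip}_0(X)$: $\mathrm{SLip}_0(X)^*$ is the cone of linear $\varphi:\mathrm{SLip}_0(X)\to\mathbb{R}$ that are upper semicontinuous, equivalently for which there is $M\ge 0$ with $\varphi(f)\le M\|f|_S$ for all $f$; $\|\varphi|^*=\sup_{\|f|_S\le 1}\varphi(f)$. For $x\in X$, $\delta_x=\delta(x)$ is the evaluation $\delta_x(f)=f(x)$. Both $\delta_x$ and $-\delta_x$ belong to $\mathrm{SLip}_0(X)^*$, so $\mathrm{span}(\delta(X))$ is a real vector space contained in $\mathrm{SLip}_0(X)^*$.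 An asymmetric normed space is a real vector space $E$ with $\|\cdot|:E\to[0,\infty)$ that is subadditive, satisfies $\|rx|=r\|x|$ for $r>0$, and either ($x=0\iff\|x|=0$) or ($x=0\iff\|x|=\|{-x}|=0$). Its symmetrization is the norm $\|x\|_s=\|x|+\|{-x}|$ (equivalently $\max\{\|x|,\|{-x}|\}$). It is bicomplete if complete for this norm. Its bicompletion is the (unique up to isometric isomorphism) bicomplete asymmetric normed space in which it embeds by a linear isometry with image dense for the symmetrized norm. The semi-Lipschitz free space $\mathcal{F}_a(X)$ is the bicompletion of the asymmetric normed space $(\mathrm{span}(\delta(X)),\|\cdot|^* )$. The dual cone of an asymmetric normed space $(E,\|\cdot|)$ is the cone $E^*$ of linear functionals $\varphi:E\to\mathbb{R}$ that are upper semicontinuous for the topology generated by the balls $\{y:\|y-x|<r\}$ (equivalently $\varphi(x)\le M\|x|$ for some $M\geq 0$ and all $x$), with $\|\varphi|^*=\sup_{\|x|\le1}\varphi(x)$. An isometric isomorphism between normed cones is a linear bijection $\Phi$ that is an isometry for the quasi-metrics $d_e(x,y)=\inf\{\|z|: y=x+z\}$ ($\inf\emptyset=+\infty$), which is equivalent to $\|\Phi x|=\|x|$ for all $x$. *)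

theory Defs
  imports "HOL-Analysis.Analysis" "HOL-Library.Function_Algebras"
begin

text \<open>
  Functions on a carrier set \<open>S\<close> are represented throughout by total functions vanishing outside
  \<open>S\<close>. Under this convention equality of functions on \<open>S\<close> is equality of the representing total
  functions, and the operations on \<open>S\<close>-functions are the pointwise operations on the function type.
\<close>

instantiation "fun" :: (type, real_vector) real_vector
begin

definition scaleR_fun_def: "r *\<^sub>R f = (\<lambda>x. r *\<^sub>R f x)"

instance
  by standard (simp_all add: scaleR_fun_def fun_eq_iff scaleR_add_right scaleR_add_left)

end

lemma scaleR_fun_apply [simp]: "(r *\<^sub>R f) x = r *\<^sub>R f x"
  by (simp add: scaleR_fun_def)

section \<open>Quasi-metric spaces and semi-Lipschitz functions\<close>

text \<open>The last assumption admits both quasi-metrics and quasi-hemi-metrics.\<close>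

locale quasi_metric_space =
  fixes X :: "'a set" and d :: "'a \<Rightarrow> 'a \<Rightarrow> real"
  assumes nonempty: "X \<noteq> {}"
    and nonneg: "\<lbrakk>x \<in> X; y \<in> X\<rbrakk> \<Longrightarrow> 0 \<le> d x y"
    and triangle: "\<lbrakk>x \<in> X; y \<in> X; z \<in> X\<rbrakk> \<Longrightarrow> d x y \<le> d x z + d z y"
    and separation: "(\<forall>x\<in>X. \<forall>y\<in>X. x = y \<longleftrightarrow> d x y = 0) \<or>
                     (\<forall>x\<in>X. \<forall>y\<in>X. x = y \<longleftrightarrow> d x y = 0 \<and> d y x = 0)"

definition semi_lipschitz_with :: "'a set \<Rightarrow> ('a \<Rightarrow> 'a \<Rightarrow> real) \<Rightarrow> real \<Rightarrow> ('a \<Rightarrow> real) \<Rightarrow> bool" where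
  "semi_lipschitz_with X d L f \<longleftrightarrow> (\<forall>x\<in>X. \<forall>y\<in>X. f x - f y \<le> L * d y x)"

definition SLip0 :: "'a set \<Rightarrow> ('a \<Rightarrow> 'a \<Rightarrow> real) \<Rightarrow> 'a \<Rightarrow> ('a \<Rightarrow> real) set" where
  "SLip0 X d x0 = {f. (\<forall>x. x \<notin> X \<longrightarrow> f x = 0) \<and> (\<exists>L>0. semi_lipschitz_with X d L f) \<and> f x0 = 0}"

definition slip_norm :: "'a set \<Rightarrow> ('a \<Rightarrow> 'a \<Rightarrow> real) \<Rightarrow> ('a \<Rightarrow> real) \<Rightarrow> real" where
  "slip_norm X d f = Inf {L. L > 0 \<and> semi_lipschitz_with X d L f}"

section \<open>Normed cones\<close>

definition dual_norm :: "'v set \<Rightarrow> ('v \<Rightarrow> real) \<Rightarrow> ('v \<Rightarrow> real) \<Rightarrow> real" where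
  "dual_norm C n \<phi> = (SUP f\<in>{f\<in>C. n f \<le> 1}. \<phi> f)"

text \<open>The infimum is taken in \<^typ>\<open>ereal\<close>, so that it is \<open>\<infinity>\<close> when \<open>y \<notin> x + C\<close>.\<close>

definition cone_dist :: "'v::real_vector set \<Rightarrow> ('v \<Rightarrow> real) \<Rightarrow> 'v \<Rightarrow> 'v \<Rightarrow> ereal" where
  "cone_dist C n x y = (INF z\<in>{z\<in>C. y = x + z}. ereal (n z))"

definition cone_isometric_isomorphism ::
  "'v::real_vector set \<Rightarrow> ('v \<Rightarrow> real) \<Rightarrow> 'w::real_vector set \<Rightarrow> ('w \<Rightarrow> real) \<Rightarrow> ('v \<Rightarrow> 'w) \<Rightarrow> bool" where
  "cone_isometric_isomorphism C m D n \<Phi> \<longleftrightarrow>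
     bij_betw \<Phi> C D \<and>
     (\<forall>x\<in>C. \<forall>y\<in>C. \<Phi> (x + y) = \<Phi> x + \<Phi> y) \<and>
     (\<forall>x\<in>C. \<forall>r\<ge>0. \<Phi> (r *\<^sub>R x) = r *\<^sub>R \<Phi> x) \<and>
     (\<forall>x\<in>C. \<forall>y\<in>C. cone_dist D n (\<Phi> x) (\<Phi> y) = cone_dist C m x y)"

section \<open>Asymmetric normed spaces\<close>

locale asym_normed_space =
  fixes E :: "'v::real_vector set" and p :: "'v \<Rightarrow> real"
  assumes subspace: "subspace E"
    and nonneg: "x \<in> E \<Longrightarrow> 0 \<le> p x"
    and subadditive: "\<lbrakk>x \<in> E; y \<in> E\<rbrakk> \<Longrightarrow> p (x + y) \<le> p x + p y"
    and homogeneous: "\<lbrakk>x \<in> E; r > 0\<rbrakk> \<Longrightarrow> p (r *\<^sub>R x) = r * p x"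
    and separation: "(\<forall>x\<in>E. x = 0 \<longleftrightarrow> p x = 0) \<or> (\<forall>x\<in>E. x = 0 \<longleftrightarrow> p x = 0 \<and> p (- x) = 0)"

text \<open>
  The distance of the symmetrized norm. It is set to \<open>0\<close> off the carrier, because
  \<^locale>\<open>Metric_space\<close> demands a symmetric nonnegative function on the whole type.
\<close>

definition sym_dist :: "'v::real_vector set \<Rightarrow> ('v \<Rightarrow> real) \<Rightarrow> 'v \<Rightarrow> 'v \<Rightarrow> real" where
  "sym_dist E p x y = (if x \<in> E \<and> y \<in> E then p (x - y) + p (- (x - y)) else 0)"

lemma (in asym_normed_space) Metric_space_sym_dist: "Metric_space E (sym_dist E p)"
proof
  have diff: "x - y \<in> E" if "x \<in> E" "y \<in> E" for x y
    using that subspace by (rule_tac subspace_diff)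
  have p0: "p 0 = 0"
    using separation subspace subspace_0 by blast
  show "0 \<le> sym_dist E p x y" for x y
    using diff[of x y] diff[of y x] nonneg by (simp add: sym_dist_def)
  show "sym_dist E p x y = sym_dist E p y x" for x y
    by (simp add: sym_dist_def)
  show "sym_dist E p x y = 0 \<longleftrightarrow> x = y" if xy: "x \<in> E" "y \<in> E" for x y
  proof
    assume "sym_dist E p x y = 0"
    then have "p (x - y) = 0 \<and> p (- (x - y)) = 0"
      using nonneg[OF diff[OF xy]] nonneg[OF diff[OF xy(2,1)]] xy by (simp add: sym_dist_def)
    then have "x - y = 0"
      using separation diff[OF xy] by blast
    then show "x = y" by simp
  qed (simp add: sym_dist_def p0)
  show "sym_dist E p x z \<le> sym_dist E p x y + sym_dist E p y z"
    if xyz: "x \<in> E" "y \<in> E" "z \<in> E" for x y z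
    using subadditive[OF diff[OF xyz(1,2)] diff[OF xyz(2,3)]]
      subadditive[OF diff[OF xyz(3,2)] diff[OF xyz(2,1)]] xyz
    by (simp add: sym_dist_def)
qed

definition bicomplete :: "'v::real_vector set \<Rightarrow> ('v \<Rightarrow> real) \<Rightarrow> bool" where
  "bicomplete E p \<longleftrightarrow> Metric_space.mcomplete E (sym_dist E p)"

definition is_bicompletion ::
  "'v::real_vector set \<Rightarrow> ('v \<Rightarrow> real) \<Rightarrow> 'w::real_vector set \<Rightarrow> ('w \<Rightarrow> real) \<Rightarrow> ('v \<Rightarrow> 'w) \<Rightarrow> bool" where
  "is_bicompletion V q E p \<iota> \<longleftrightarrow>
     asym_normed_space E p \<and> bicomplete E p \<and>
     \<iota> ` V \<subseteq> E \<and>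
     (\<forall>x\<in>V. \<forall>y\<in>V. \<iota> (x + y) = \<iota> x + \<iota> y) \<and>
     (\<forall>x\<in>V. \<forall>r. \<iota> (r *\<^sub>R x) = r *\<^sub>R \<iota> x) \<and>
     (\<forall>x\<in>V. p (\<iota> x) = q x) \<and>
     (Metric_space.mtopology E (sym_dist E p)) closure_of (\<iota> ` V) = E"

definition asym_topology :: "'v::real_vector set \<Rightarrow> ('v \<Rightarrow> real) \<Rightarrow> 'v topology" where
  "asym_topology E p = topology_generated_by {{y\<in>E. p (y - x) < r} | x r. x \<in> E \<and> r > 0}"

definition upper_semicontinuous_map :: "'v topology \<Rightarrow> ('v \<Rightarrow> real) \<Rightarrow> bool" where
  "upper_semicontinuous_map T \<phi> \<longleftrightarrow> (\<forall>c. openin T {x \<in> topspace T. \<phi> x < c})"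

definition dual_cone :: "'v::real_vector set \<Rightarrow> ('v \<Rightarrow> real) \<Rightarrow> ('v \<Rightarrow> real) set" where
  "dual_cone E p = {\<phi>. (\<forall>x. x \<notin> E \<longrightarrow> \<phi> x = 0) \<and>
     (\<forall>x\<in>E. \<forall>y\<in>E. \<phi> (x + y) = \<phi> x + \<phi> y) \<and>
     (\<forall>x\<in>E. \<forall>r. \<phi> (r *\<^sub>R x) = r * \<phi> x) \<and>
     upper_semicontinuous_map (asym_topology E p) \<phi>}"

section \<open>The semi-Lipschitz free space\<close>

definition delta :: "'a set \<Rightarrow> ('a \<Rightarrow> 'a \<Rightarrow> real) \<Rightarrow> 'a \<Rightarrow> 'a \<Rightarrow> ('a \<Rightarrow> real) \<Rightarrow> real" where
  "delta X d x0 x = (\<lambda>f. if f \<in> SLip0 X d x0 then f x else 0)"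

text \<open>
  The bicompletion is determined only up to isometric isomorphism, so the free space is specified
  by a predicate rather than by a chosen model. Existence of a model is shown below.
\<close>

definition is_semi_lipschitz_free_space ::
  "'a set \<Rightarrow> ('a \<Rightarrow> 'a \<Rightarrow> real) \<Rightarrow> 'a \<Rightarrow> 'e::real_vector set \<Rightarrow> ('e \<Rightarrow> real) \<Rightarrow> bool" where
  "is_semi_lipschitz_free_space X d x0 F p \<longleftrightarrow>
     (\<exists>\<iota>. is_bicompletion (span (delta X d x0 ` X)) (dual_norm (SLip0 X d x0) (slip_norm X d)) F p \<iota>)"

context quasi_metric_space
begin

lemma slip_norm_nonneg: "f \<in> SLip0 X d x0 \<Longrightarrow> 0 \<le> slip_norm X d f"
  unfolding slip_norm_def SLip0_def by (rule cInf_greatest) auto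

lemma slip_norm_bound:
  assumes f: "f \<in> SLip0 X d x0" and x: "x \<in> X" and y: "y \<in> X"
  shows "f x - f y \<le> slip_norm X d f * d y x"
proof -
  have ex: "\<exists>L>0. semi_lipschitz_with X d L f"
    using f by (simp add: SLip0_def)
  show ?thesis
  proof (cases "d y x = 0")
    case True
    with ex x y show ?thesis by (force simp: semi_lipschitz_with_def)
  next
    case False
    then have pos: "d y x > 0" using nonneg[OF y x] by simp
    have "(f x - f y) / d y x \<le> slip_norm X d f"
      unfolding slip_norm_def
      using ex pos x y by (intro cInf_greatest) (auto simp: semi_lipschitz_with_def field_simps)
    then show ?thesis using pos by (simp add: field_simps)
  qed
qed

lemma slip_norm_le:
  assumes "c \<ge> 0" "semi_lipschitz_with X d c f"
  shows "slip_norm X d f \<le> c"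
proof (rule field_le_epsilon)
  fix e :: real assume "e > 0"
  have "f x - f y \<le> (c + e) * d y x" if "x \<in> X" "y \<in> X" for x y
  proof -
    have "f x - f y \<le> c * d y x" using assms that by (simp add: semi_lipschitz_with_def)
    also have "\<dots> \<le> (c + e) * d y x"
      using nonneg that \<open>e > 0\<close> by (intro mult_right_mono) auto
    finally show ?thesis .
  qed
  with \<open>e > 0\<close> assms(1) show "slip_norm X d f \<le> c + e"
    unfolding slip_norm_def
    by (intro cInf_lower bdd_belowI[of _ 0]) (auto simp: semi_lipschitz_with_def)
qed

lemma SLip0_zero: "0 \<in> SLip0 X d x0"
  using nonneg by (auto simp: SLip0_def semi_lipschitz_with_def intro!: exI[of _ 1])

lemma slip_norm_zero: "slip_norm X d 0 = 0"
proof (rule antisym)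
  show "slip_norm X d 0 \<le> 0"
    by (rule slip_norm_le) (auto simp: semi_lipschitz_with_def)
  show "0 \<le> slip_norm X d 0"
    by (rule slip_norm_nonneg[OF SLip0_zero])
qed

lemma SLip0_scaleR:
  assumes f: "f \<in> SLip0 X d x0" and r: "r \<ge> 0"
  shows "r *\<^sub>R f \<in> SLip0 X d x0" "slip_norm X d (r *\<^sub>R f) \<le> r * slip_norm X d f"
proof -
  show "slip_norm X d (r *\<^sub>R f) \<le> r * slip_norm X d f"
  proof (rule slip_norm_le)
    show "0 \<le> r * slip_norm X d f" using r slip_norm_nonneg[OF f] by simp
    show "semi_lipschitz_with X d (r * slip_norm X d f) (r *\<^sub>R f)"
      unfolding semi_lipschitz_with_def
    proof (intro ballI)
      fix x y assume "x \<in> X" "y \<in> X"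
      from mult_left_mono[OF slip_norm_bound[OF f this] r]
      show "(r *\<^sub>R f) x - (r *\<^sub>R f) y \<le> r * slip_norm X d f * d y x"
        by (simp add: algebra_simps)
    qed
  qed
  show "r *\<^sub>R f \<in> SLip0 X d x0"
  proof (cases "r = 0")
    case True then show ?thesis using SLip0_zero by simp
  next
    case False
    then have r: "r > 0" using r by simp
    obtain L where L: "L > 0" "semi_lipschitz_with X d L f" using f by (auto simp: SLip0_def)
    have "semi_lipschitz_with X d (r * L) (r *\<^sub>R f)"
      unfolding semi_lipschitz_with_def
    proof (intro ballI)
      fix x y assume "x \<in> X" "y \<in> X"
      then have "r * (f x - f y) \<le> r * (L * d y x)"
        using L r by (intro mult_left_mono) (auto simp: semi_lipschitz_with_def)
      then show "(r *\<^sub>R f) x - (r *\<^sub>R f) y \<le> r * L * d y x" by (simp add: algebra_simps)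
    qed
    with f r L show ?thesis
      by (auto simp: SLip0_def intro!: exI[of _ "r * L"])
  qed
qed

lemma slip_norm_eq_0:
  assumes f: "f \<in> SLip0 X d x0" and x0: "x0 \<in> X" and 0: "slip_norm X d f = 0"
  shows "f = 0"
proof
  fix x
  show "f x = 0 x"
  proof (cases "x \<in> X")
    case True
    then show ?thesis
      using slip_norm_bound[OF f True x0] slip_norm_bound[OF f x0 True] 0 f
      by (simp add: SLip0_def)
  next
    case False then show ?thesis using f by (simp add: SLip0_def)
  qed
qed

lemma semi_lipschitz_free_space_exists:
  assumes x0: "x0 \<in> X"
  shows "\<exists>(F :: (('a \<Rightarrow> real) \<Rightarrow> real) set) p. is_semi_lipschitz_free_space X d x0 F p"
proof -
  define W where "W = SLip0 X d x0"
  define n where "n = slip_norm X d"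
  define V where "V = span (delta X d x0 ` X)"
  define q where "q = dual_norm W n"
  define E where "E = {\<phi> :: ('a \<Rightarrow> real) \<Rightarrow> real. (\<forall>f. f \<notin> W \<longrightarrow> \<phi> f = 0) \<and>
     (\<forall>e>0. \<exists>v\<in>V. \<forall>f\<in>W. \<bar>\<phi> f - v f\<bar> \<le> e * n f)}"
  have n0: "n f \<ge> 0" if "f \<in> W" for f
    using that slip_norm_nonneg by (simp add: W_def n_def)
  have W0: "0 \<in> W" "n 0 = 0"
    by (auto simp: W_def n_def SLip0_zero slip_norm_zero)
  have Ws: "r *\<^sub>R f \<in> W" "n (r *\<^sub>R f) \<le> r * n f" if "f \<in> W" "r \<ge> 0" for r f
    using that SLip0_scaleR by (auto simp: W_def n_def)
  have n_eq0: "f = 0" if "f \<in> W" "n f = 0" for f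
    using that slip_norm_eq_0 x0 by (simp add: W_def n_def)

  have Vprop: "(\<forall>f. f \<notin> W \<longrightarrow> v f = 0) \<and> (\<forall>f\<in>W. \<forall>r\<ge>0. v (r *\<^sub>R f) = r * v f) \<and>
      (\<exists>M\<ge>0. \<forall>f\<in>W. \<bar>v f\<bar> \<le> M * n f)" if "v \<in> V" for v
    using that unfolding V_def
  proof (induction rule: span_induct_alt)
    case base
    show ?case by (auto intro!: exI[of _ 0])
  next
    case (step c a v)
    then obtain x where x: "x \<in> X" "a = delta X d x0 x" by auto
    obtain M where M: "M \<ge> 0" "\<And>f. f \<in> W \<Longrightarrow> \<bar>v f\<bar> \<le> M * n f" using step by blast
    define D where "D = d x0 x + d x x0"
    have D: "D \<ge> 0" using nonneg x x0 by (simp add: D_def)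
    have a: "\<bar>a f\<bar> \<le> D * n f" if "f \<in> W" for f
    proof -
      have "f x0 = 0" using that by (simp add: W_def SLip0_def)
      moreover have "f x - f x0 \<le> n f * d x0 x" "f x0 - f x \<le> n f * d x x0"
        using slip_norm_bound x x0 that by (auto simp: W_def n_def)
      moreover have "n f * d x0 x \<ge> 0" "n f * d x x0 \<ge> 0"
        using nonneg x x0 n0[OF that] by auto
      ultimately have "\<bar>f x\<bar> \<le> D * n f" by (simp add: D_def algebra_simps abs_le_iff)
      then show ?thesis using that x by (simp add: delta_def W_def)
    qed
    have "\<bar>(c *\<^sub>R a + v) f\<bar> \<le> (\<bar>c\<bar> * D + M) * n f" if "f \<in> W" for f
    proof -
      have "\<bar>(c *\<^sub>R a + v) f\<bar> \<le> \<bar>c\<bar> * \<bar>a f\<bar> + \<bar>v f\<bar>"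
        by (simp add: abs_mult[symmetric])
      also have "\<dots> \<le> \<bar>c\<bar> * (D * n f) + M * n f"
        using a[OF that] M(2)[OF that] by (intro add_mono mult_left_mono) auto
      finally show ?thesis by (simp add: algebra_simps)
    qed
    moreover have "\<bar>c\<bar> * D + M \<ge> 0" using D M by simp
    ultimately have "\<exists>M\<ge>0. \<forall>f\<in>W. \<bar>(c *\<^sub>R a + v) f\<bar> \<le> M * n f" by blast
    moreover have "(c *\<^sub>R a + v) f = 0" if "f \<notin> W" for f
      using that x step by (simp add: delta_def W_def)
    moreover have "(c *\<^sub>R a + v) (r *\<^sub>R f) = r * (c *\<^sub>R a + v) f" if "f \<in> W" "r \<ge> 0" for f r
    proof -
      have "v (r *\<^sub>R f) = r * v f" using step that by blast
      moreover have "a (r *\<^sub>R f) = r * a f"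
        using that x Ws(1)[OF that] by (simp add: delta_def W_def)
      ultimately show ?thesis by (simp add: distrib_left)
    qed
    ultimately show ?case by blast
  qed

  have VE: "V \<subseteq> E"
  proof
    fix v assume v: "v \<in> V"
    show "v \<in> E"
      unfolding E_def using Vprop[OF v] n0 v by (auto intro!: bexI[of _ v])
  qed
  have Eapp: "\<exists>v\<in>V. \<forall>f\<in>W. \<bar>\<phi> f - v f\<bar> \<le> e * n f" if "\<phi> \<in> E" "e > 0" for \<phi> e
    using that by (auto simp: E_def)
  have Eoff: "\<phi> f = 0" if "\<phi> \<in> E" "f \<notin> W" for \<phi> f
    using that by (auto simp: E_def)
  have Ebd: "\<exists>M\<ge>0. \<forall>f\<in>W. \<bar>\<phi> f\<bar> \<le> M * n f" if \<phi>: "\<phi> \<in> E" for \<phi>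
  proof -
    obtain v where v: "v \<in> V" "\<And>f. f \<in> W \<Longrightarrow> \<bar>\<phi> f - v f\<bar> \<le> 1 * n f"
      using Eapp[OF \<phi>, of 1] by auto
    obtain M where M: "M \<ge> 0" "\<And>f. f \<in> W \<Longrightarrow> \<bar>v f\<bar> \<le> M * n f" using Vprop[OF v(1)] by blast
    have "\<bar>\<phi> f\<bar> \<le> (M + 1) * n f" if "f \<in> W" for f
      using v(2)[OF that] M(2)[OF that] by (simp add: algebra_simps abs_le_iff)
    with M(1) show ?thesis by (intro exI[of _ "M + 1"]) auto
  qed
  have Ehom: "\<phi> (r *\<^sub>R f) = r * \<phi> f" if \<phi>: "\<phi> \<in> E" and f: "f \<in> W" and r: "r \<ge> 0" for \<phi> r f
  proof -
    have "\<bar>\<phi> (r *\<^sub>R f) - r * \<phi> f\<bar> \<le> 0 + e" if e: "e > 0" for e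
    proof -
      define c where "c = e / (2 * (r * n f) + 1)"
      have rn: "r * n f \<ge> 0" using r n0[OF f] by simp
      have c: "c > 0" using e rn by (simp add: c_def)
      obtain v where v: "v \<in> V" "\<And>f. f \<in> W \<Longrightarrow> \<bar>\<phi> f - v f\<bar> \<le> c * n f"
        using Eapp[OF \<phi> c] by auto
      have "\<bar>\<phi> (r *\<^sub>R f) - v (r *\<^sub>R f)\<bar> \<le> c * (r * n f)"
        using order_trans[OF v(2)[OF Ws(1)[OF f r]] mult_left_mono[OF Ws(2)[OF f r]]] c by simp
      moreover have "\<bar>r * \<phi> f - r * v f\<bar> \<le> c * (r * n f)"
      proof -
        have "\<bar>r * \<phi> f - r * v f\<bar> = r * \<bar>\<phi> f - v f\<bar>"
          using r by (simp add: abs_mult right_diff_distrib[symmetric])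
        then show ?thesis using mult_left_mono[OF v(2)[OF f] r] by (simp add: mult.left_commute)
      qed
      moreover have "v (r *\<^sub>R f) = r * v f" using Vprop[OF v(1)] f r by blast
      ultimately have "\<bar>\<phi> (r *\<^sub>R f) - r * \<phi> f\<bar> \<le> c * (2 * (r * n f))" by linarith
      also have "\<dots> \<le> c * (2 * (r * n f) + 1)" using c by (intro mult_left_mono) auto
      also have "\<dots> = e" using rn by (simp add: c_def)
      finally show ?thesis by simp
    qed
    then have "\<bar>\<phi> (r *\<^sub>R f) - r * \<phi> f\<bar> \<le> 0" by (rule field_le_epsilon)
    then show ?thesis by simp
  qed
  have Esub: "subspace E"
    unfolding subspace_def
  proof (intro conjI ballI allI)
    show "0 \<in> E"
      using VE span_0 by (auto simp: V_def)
    fix \<phi> \<psi> c assume \<phi>: "\<phi> \<in> E"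
    show "c *\<^sub>R \<phi> \<in> E"
      unfolding E_def
    proof (intro CollectI conjI allI impI)
      fix e :: real assume e: "e > 0"
      have pos: "e / (\<bar>c\<bar> + 1) > 0" using e by (simp add: add_pos_nonneg)
      obtain v where v: "v \<in> V" "\<And>f. f \<in> W \<Longrightarrow> \<bar>\<phi> f - v f\<bar> \<le> e / (\<bar>c\<bar> + 1) * n f"
        using Eapp[OF \<phi> pos] by auto
      have "\<bar>(c *\<^sub>R \<phi>) f - (c *\<^sub>R v) f\<bar> \<le> e * n f" if f: "f \<in> W" for f
      proof -
        have "\<bar>(c *\<^sub>R \<phi>) f - (c *\<^sub>R v) f\<bar> = \<bar>c\<bar> * \<bar>\<phi> f - v f\<bar>"
          by (simp add: abs_mult[symmetric] right_diff_distrib)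
        also have "\<dots> \<le> (\<bar>c\<bar> + 1) * (e / (\<bar>c\<bar> + 1) * n f)"
          using v(2)[OF f] by (intro mult_mono) auto
        also have "\<dots> = e * n f"
        proof -
          have "\<bar>c\<bar> + 1 \<noteq> 0" by linarith
          then show ?thesis by simp
        qed
        finally show ?thesis .
      qed
      moreover have "c *\<^sub>R v \<in> V" using v(1) unfolding V_def by (rule span_scale)
      ultimately show "\<exists>v\<in>V. \<forall>f\<in>W. \<bar>(c *\<^sub>R \<phi>) f - v f\<bar> \<le> e * n f" by blast
    qed (simp add: Eoff[OF \<phi>])
    assume \<psi>: "\<psi> \<in> E"
    show "\<phi> + \<psi> \<in> E"
      unfolding E_def
    proof (intro CollectI conjI allI impI)
      fix e :: real assume e: "e > 0"
      obtain v where v: "v \<in> V" "\<And>f. f \<in> W \<Longrightarrow> \<bar>\<phi> f - v f\<bar> \<le> e / 2 * n f"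
        using Eapp[OF \<phi>, of "e / 2"] e by auto
      obtain w where w: "w \<in> V" "\<And>f. f \<in> W \<Longrightarrow> \<bar>\<psi> f - w f\<bar> \<le> e / 2 * n f"
        using Eapp[OF \<psi>, of "e / 2"] e by auto
      have "\<bar>(\<phi> + \<psi>) f - (v + w) f\<bar> \<le> e * n f" if f: "f \<in> W" for f
        using v(2)[OF f] w(2)[OF f] unfolding plus_fun_apply by linarith
      moreover have "v + w \<in> V" using v(1) w(1) unfolding V_def by (rule span_add)
      ultimately show "\<exists>v\<in>V. \<forall>f\<in>W. \<bar>(\<phi> + \<psi>) f - v f\<bar> \<le> e * n f" by blast
    qed (simp add: Eoff[OF \<phi>] Eoff[OF \<psi>])
  qed

  have bdd: "bdd_above (\<phi> ` {f\<in>W. n f \<le> 1})" if \<phi>: "\<phi> \<in> E" for \<phi>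
  proof -
    obtain M where M: "M \<ge> 0" "\<And>f. f \<in> W \<Longrightarrow> \<bar>\<phi> f\<bar> \<le> M * n f" using Ebd[OF \<phi>] by blast
    have "\<phi> f \<le> M" if "f \<in> W" "n f \<le> 1" for f
      using M(2)[OF that(1)] mult_left_mono[OF that(2) M(1)] by simp
    then show ?thesis by (intro bdd_aboveI[of _ M]) auto
  qed
  have \<phi>0: "\<phi> 0 = 0" if "\<phi> \<in> E" for \<phi>
    using Ehom[OF that W0(1), of 0] by simp
  have q_nonneg: "q \<phi> \<ge> 0" if "\<phi> \<in> E" for \<phi>
    using cSUP_upper[OF _ bdd[OF that], of 0] W0 \<phi>0[OF that] by (simp add: q_def dual_norm_def)
  have q_le: "q \<phi> \<le> c" if "c \<ge> 0" "\<And>f. f \<in> W \<Longrightarrow> \<phi> f \<le> c * n f" for \<phi> c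
    unfolding q_def dual_norm_def
  proof (rule cSUP_least)
    show "{f \<in> W. n f \<le> 1} \<noteq> {}" using W0 by auto
    fix f assume f: "f \<in> {f \<in> W. n f \<le> 1}"
    then have "\<phi> f \<le> c * n f" using that by simp
    also have "\<dots> \<le> c * 1" using f that(1) by (intro mult_left_mono) auto
    finally show "\<phi> f \<le> c" by simp
  qed
  have q_up: "\<phi> f \<le> q \<phi> * n f" if \<phi>: "\<phi> \<in> E" and f: "f \<in> W" for \<phi> f
  proof (cases "n f = 0")
    case True
    then show ?thesis using n_eq0[OF f True] \<phi>0[OF \<phi>] by simp
  next
    case False
    then have pos: "n f > 0" using n0[OF f] by simp
    let ?g = "(1 / n f) *\<^sub>R f"
    have "?g \<in> W" "n ?g \<le> 1" using Ws[OF f, of "1 / n f"] pos by auto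
    then have "\<phi> ?g \<le> q \<phi>"
      unfolding q_def dual_norm_def by (intro cSUP_upper bdd \<phi> CollectI conjI)
    then show ?thesis using Ehom[OF \<phi> f, of "1 / n f"] pos by (simp add: field_simps)
  qed
  have Em: "- \<phi> \<in> E" if "\<phi> \<in> E" for \<phi> using that Esub by (rule_tac subspace_neg)
  interpret E: asym_normed_space E q
  proof
    show "subspace E" by (rule Esub)
    show "0 \<le> q \<phi>" if "\<phi> \<in> E" for \<phi> using that by (rule q_nonneg)
    show "q (\<phi> + \<psi>) \<le> q \<phi> + q \<psi>" if "\<phi> \<in> E" "\<psi> \<in> E" for \<phi> \<psi>
    proof (rule q_le)
      show "(\<phi> + \<psi>) f \<le> (q \<phi> + q \<psi>) * n f" if f: "f \<in> W" for f
        using q_up[OF \<open>\<phi> \<in> E\<close> f] q_up[OF \<open>\<psi> \<in> E\<close> f] by (simp add: algebra_simps)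
    qed (use that q_nonneg in auto)
    have le: "q (r *\<^sub>R \<phi>) \<le> r * q \<phi>" if "\<phi> \<in> E" "r > 0" for \<phi> r
    proof (rule q_le)
      show "(r *\<^sub>R \<phi>) f \<le> r * q \<phi> * n f" if f: "f \<in> W" for f
        using mult_left_mono[OF q_up[OF \<open>\<phi> \<in> E\<close> f], of r] \<open>r > 0\<close> by (simp add: algebra_simps)
    qed (use that q_nonneg in auto)
    show "q (r *\<^sub>R \<phi>) = r * q \<phi>" if \<phi>: "\<phi> \<in> E" and r: "r > 0" for \<phi> r
    proof (rule antisym[OF le[OF \<phi> r]])
      have "q ((1 / r) *\<^sub>R r *\<^sub>R \<phi>) \<le> (1 / r) * q (r *\<^sub>R \<phi>)"
        using r subspace_scale[OF Esub \<phi>] by (intro le) auto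
      then show "r * q \<phi> \<le> q (r *\<^sub>R \<phi>)" using r by (simp add: field_simps)
    qed
    have "\<phi> = 0" if "\<phi> \<in> E" "q \<phi> = 0" "q (- \<phi>) = 0" for \<phi>
    proof
      fix f show "\<phi> f = 0 f"
        using q_up[OF that(1), of f] q_up[OF Em[OF that(1)], of f] Eoff[OF that(1), of f] that
        by (cases "f \<in> W") auto
    qed
    moreover have "q 0 = 0"
      using q_le[of 0 0] q_nonneg[OF subspace_0[OF Esub]] by simp
    ultimately show "(\<forall>x\<in>E. (x = 0) = (q x = 0)) \<or> (\<forall>x\<in>E. (x = 0) = (q x = 0 \<and> q (- x) = 0))"
      by auto
  qed
  interpret M: Metric_space E "sym_dist E q" by (rule E.Metric_space_sym_dist)
  have dist_le: "sym_dist E q \<phi> \<psi> \<le> 2 * c"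
    if "\<phi> \<in> E" "\<psi> \<in> E" "c \<ge> 0" "\<And>f. f \<in> W \<Longrightarrow> \<bar>\<phi> f - \<psi> f\<bar> \<le> c * n f" for \<phi> \<psi> c
  proof -
    have "q (\<phi> - \<psi>) \<le> c" "q (- (\<phi> - \<psi>)) \<le> c"
      by (rule q_le; use that in \<open>force simp: abs_le_iff\<close>)+
    then show ?thesis using that by (simp add: sym_dist_def)
  qed
  have dist_up: "\<bar>\<phi> f - \<psi> f\<bar> \<le> sym_dist E q \<phi> \<psi> * n f"
    if \<phi>: "\<phi> \<in> E" and \<psi>: "\<psi> \<in> E" and f: "f \<in> W" for \<phi> \<psi> f
  proof -
    have D: "\<phi> - \<psi> \<in> E" using Esub \<phi> \<psi> by (rule subspace_diff)
    have "q (\<phi> - \<psi>) * n f \<ge> 0" "q (- (\<phi> - \<psi>)) * n f \<ge> 0"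
      using q_nonneg[OF D] q_nonneg[OF Em[OF D]] n0[OF f] by auto
    with q_up[OF D f] q_up[OF Em[OF D] f] \<phi> \<psi> show ?thesis
      by (simp add: sym_dist_def distrib_right abs_le_iff)
  qed

  have complete: "bicomplete E q"
    unfolding bicomplete_def M.mcomplete_def
  proof (intro allI impI)
    fix \<sigma> assume \<sigma>: "M.MCauchy \<sigma>"
    then have \<sigma>E: "\<sigma> k \<in> E" for k by (auto simp: M.MCauchy_def)
    have C: "\<exists>N. \<forall>k\<ge>N. \<forall>l\<ge>N. \<forall>f\<in>W. \<bar>\<sigma> k f - \<sigma> l f\<bar> \<le> e * n f" if e: "e > 0" for e
    proof -
      obtain N where N: "\<And>k l. k \<ge> N \<Longrightarrow> l \<ge> N \<Longrightarrow> sym_dist E q (\<sigma> k) (\<sigma> l) < e"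
        using \<sigma> e unfolding M.MCauchy_def by blast
      have "\<bar>\<sigma> k f - \<sigma> l f\<bar> \<le> e * n f" if "k \<ge> N" "l \<ge> N" "f \<in> W" for k l f
        using dist_up[OF \<sigma>E \<sigma>E that(3), of k l]
          mult_right_mono[OF less_imp_le[OF N[OF that(1,2)]] n0[OF that(3)]] by linarith
      then show ?thesis by blast
    qed
    have "convergent (\<lambda>k. \<sigma> k f)" for f
    proof (cases "f \<in> W")
      case True
      have "Cauchy (\<lambda>k. \<sigma> k f)"
      proof (rule metric_CauchyI)
        fix e :: real assume e: "e > 0"
        have pos: "e / (n f + 1) > 0" using e n0[OF True] by simp
        obtain N where N: "\<And>k l. k \<ge> N \<Longrightarrow> l \<ge> N \<Longrightarrow> \<bar>\<sigma> k f - \<sigma> l f\<bar> \<le> e / (n f + 1) * n f"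
          using C[OF pos] True by blast
        have "e / (n f + 1) * n f < e" using e n0[OF True] by (simp add: field_simps)
        with N show "\<exists>M. \<forall>m\<ge>M. \<forall>k\<ge>M. dist (\<sigma> m f) (\<sigma> k f) < e"
          by (metis dist_real_def le_less_trans)
      qed
      then show ?thesis by (simp add: Cauchy_convergent_iff)
    next
      case False then show ?thesis using Eoff[OF \<sigma>E] by (simp add: convergent_const)
    qed
    then obtain \<phi> where \<phi>: "(\<lambda>k. \<sigma> k f) \<longlonglongrightarrow> \<phi> f" for f
      unfolding convergent_def by metis
    have lim: "\<exists>N. \<forall>k\<ge>N. \<forall>f\<in>W. \<bar>\<phi> f - \<sigma> k f\<bar> \<le> e * n f" if e: "e > 0" for e
    proof -
      obtain N where N: "\<And>k l f. k \<ge> N \<Longrightarrow> l \<ge> N \<Longrightarrow> f \<in> W \<Longrightarrow> \<bar>\<sigma> k f - \<sigma> l f\<bar> \<le> e * n f"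
        using C[OF e] by blast
      have "\<bar>\<phi> f - \<sigma> k f\<bar> \<le> e * n f" if "k \<ge> N" "f \<in> W" for k f
      proof (rule LIMSEQ_le_const2)
        show "(\<lambda>l. \<bar>\<sigma> l f - \<sigma> k f\<bar>) \<longlonglongrightarrow> \<bar>\<phi> f - \<sigma> k f\<bar>" by (intro tendsto_intros \<phi>)
        show "\<exists>N. \<forall>l\<ge>N. \<bar>\<sigma> l f - \<sigma> k f\<bar> \<le> e * n f" using N that by blast
      qed
      then show ?thesis by blast
    qed
    have \<phi>E: "\<phi> \<in> E"
      unfolding E_def
    proof (intro CollectI conjI allI impI)
      fix f assume "f \<notin> W"
      then have "\<sigma> k f = 0" for k using Eoff[OF \<sigma>E] by simp
      then show "\<phi> f = 0" using \<phi>[of f] LIMSEQ_unique[OF tendsto_const] by fastforce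
    next
      fix e :: real assume e: "e > 0"
      obtain k where k: "\<And>f. f \<in> W \<Longrightarrow> \<bar>\<phi> f - \<sigma> k f\<bar> \<le> e / 2 * n f"
        using lim[of "e / 2"] e by auto
      obtain v where v: "v \<in> V" "\<And>f. f \<in> W \<Longrightarrow> \<bar>\<sigma> k f - v f\<bar> \<le> e / 2 * n f"
        using Eapp[OF \<sigma>E, of "e / 2"] e by force
      have "\<bar>\<phi> f - v f\<bar> \<le> e * n f" if "f \<in> W" for f
        using k[OF that] v(2)[OF that] by linarith
      with v(1) show "\<exists>v\<in>V. \<forall>f\<in>W. \<bar>\<phi> f - v f\<bar> \<le> e * n f" by blast
    qed
    have "limitin M.mtopology \<sigma> \<phi> sequentially"
      unfolding M.limit_metric_sequentially
    proof (intro conjI \<phi>E allI impI)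
      fix e :: real assume e: "e > 0"
      obtain N where N: "\<And>k f. k \<ge> N \<Longrightarrow> f \<in> W \<Longrightarrow> \<bar>\<phi> f - \<sigma> k f\<bar> \<le> e / 3 * n f"
        using lim[of "e / 3"] e by auto
      have "sym_dist E q (\<sigma> k) \<phi> < e" if "k \<ge> N" for k
        using dist_le[OF \<sigma>E \<phi>E, of "e / 3" k] N[OF that] e by (simp add: abs_minus_commute)
      with \<sigma>E show "\<exists>N. \<forall>k\<ge>N. \<sigma> k \<in> E \<and> sym_dist E q (\<sigma> k) \<phi> < e" by blast
    qed
    then show "\<exists>\<phi>. limitin M.mtopology \<sigma> \<phi> sequentially" by blast
  qed

  have dense: "M.mtopology closure_of V = E"
  proof
    show "M.mtopology closure_of V \<subseteq> E"
      using closure_of_subset_topspace[of M.mtopology V] by simp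
    show "E \<subseteq> M.mtopology closure_of V"
    proof
      fix \<phi> assume \<phi>: "\<phi> \<in> E"
      have "\<exists>v\<in>V. v \<in> M.mball \<phi> e" if e: "e > 0" for e
      proof -
        obtain v where v: "v \<in> V" "\<And>f. f \<in> W \<Longrightarrow> \<bar>\<phi> f - v f\<bar> \<le> e / 3 * n f"
          using Eapp[OF \<phi>, of "e / 3"] e by force
        have vE: "v \<in> E" using VE v(1) by blast
        have "sym_dist E q \<phi> v < e"
          using dist_le[OF \<phi> vE, of "e / 3"] v(2) e by simp
        with v(1) vE \<phi> show ?thesis by auto
      qed
      with \<phi> show "\<phi> \<in> M.mtopology closure_of V"
        by (auto simp: M.metric_closure_of)
    qed
  qed
  have "is_bicompletion V q E q (\<lambda>v. v)"
    unfolding is_bicompletion_def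
    using E.asym_normed_space_axioms complete VE dense by auto
  then show ?thesis
    unfolding is_semi_lipschitz_free_space_def V_def q_def W_def n_def by blast
qed

end

end

theory Submission
  imports Defs
begin

text \<open>
  The isomorphism restricts a functional \<open>\<phi>\<close> on the free space to the points of \<open>X\<close>, sending it to
  \<open>x \<mapsto> \<phi> (\<iota> \<delta>\<^sub>x)\<close>. Two estimates make it work. First, \<open>\<parallel>\<delta>\<^sub>x - \<delta>\<^sub>y| \<le> d y x\<close>
  (\<open>dual_norm_delta_diff_le\<close>), so the restriction of \<open>\<phi>\<close> is semi-Lipschitz with constant \<open>\<parallel>\<phi>|\<close>.
  Second, every \<open>f\<close> in the cone acts on the span of the evaluations by \<open>v \<mapsto> v f\<close>, and
  \<open>v f \<le> \<parallel>v| \<parallel>f|\<close> (\<open>span_delta_le\<close>).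

  The second estimate yields the inverse map. The functional \<open>v \<mapsto> v f\<close> extends from the dense image of
  the span to the whole free space with the same bound \<open>\<parallel>f|\<close> (\<open>extend_from_dense_subspace\<close>). A
  functional in the dual cone is continuous for the symmetrized norm, so it is determined by its
  values on a dense subspace (\<open>dual_cone_eqI_dense\<close>), and these are in turn determined by its values at
  the evaluations. Hence \<open>\<phi>\<close> is the extension of its own restriction, which gives bijectivity and
  the remaining inequality between the norms at once.

  Finally, an additive norm-preserving bijection of cones preserves the extended quasi-metrics
  (\<open>cone_isometric_isomorphismI\<close>), since these are defined through addition and the norm alone.
\<close>

section \<open>The dual norm on a cone\<close>

text \<open>
  Both duals in question, that of the cone of semi-Lipschitz functions and that of an asymmetric
  normed space, obey the usual estimates of an operator norm. What the two domains share is recorded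
  here: multiplication by nonnegative scalars and a functional compatible with it.
\<close>

locale gauge_cone =
  fixes C :: "'v::real_vector set" and n :: "'v \<Rightarrow> real"
  assumes zero_mem: "0 \<in> C"
    and gauge_zero: "n 0 = 0"
    and gauge_nonneg: "f \<in> C \<Longrightarrow> 0 \<le> n f"
    and scale_mem: "\<lbrakk>f \<in> C; r \<ge> 0\<rbrakk> \<Longrightarrow> r *\<^sub>R f \<in> C"
    and gauge_scale_le: "\<lbrakk>f \<in> C; r \<ge> 0\<rbrakk> \<Longrightarrow> n (r *\<^sub>R f) \<le> r * n f"
begin

lemma bdd_above_unit_ball:
  assumes "M \<ge> 0" and "\<And>f. f \<in> C \<Longrightarrow> \<phi> f \<le> M * n f"
  shows "bdd_above (\<phi> ` {f \<in> C. n f \<le> 1})"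
proof (rule bdd_aboveI[of _ M])
  fix t assume "t \<in> \<phi> ` {f \<in> C. n f \<le> 1}"
  then obtain f where f: "f \<in> C" "n f \<le> 1" "t = \<phi> f" by auto
  with assms(2)[OF f(1)] mult_left_mono[OF f(2) assms(1)] show "t \<le> M" by simp
qed

lemma dual_norm_le:
  assumes "M \<ge> 0" and "\<And>f. f \<in> C \<Longrightarrow> \<phi> f \<le> M * n f"
  shows "dual_norm C n \<phi> \<le> M"
  unfolding dual_norm_def
proof (rule cSUP_least)
  show "{f \<in> C. n f \<le> 1} \<noteq> {}" using zero_mem gauge_zero by auto
  fix f assume f: "f \<in> {f \<in> C. n f \<le> 1}"
  then show "\<phi> f \<le> M"
    using assms(2)[of f] mult_left_mono[of "n f" 1 M] assms(1) by simp
qed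

lemma dual_norm_nonneg:
  assumes "M \<ge> 0" and "\<And>f. f \<in> C \<Longrightarrow> \<phi> f \<le> M * n f" and "\<phi> 0 = 0"
  shows "0 \<le> dual_norm C n \<phi>"
  using cSUP_upper[OF _ bdd_above_unit_ball[OF assms(1,2)], of 0] zero_mem gauge_zero assms(3)
  by (simp add: dual_norm_def)

text \<open>
  Rescaling \<open>f\<close> into the unit ball proves this when \<open>n f > 0\<close>. When \<open>n f = 0\<close> no rescaling is
  available, and the bound by some \<open>M\<close> is what forces \<open>\<phi> f \<le> 0\<close>.
\<close>

lemma le_dual_norm_mult:
  assumes M: "M \<ge> 0" "\<And>f. f \<in> C \<Longrightarrow> \<phi> f \<le> M * n f"
    and hom: "\<And>f r. \<lbrakk>f \<in> C; r \<ge> 0\<rbrakk> \<Longrightarrow> \<phi> (r *\<^sub>R f) = r * \<phi> f"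
    and f: "f \<in> C"
  shows "\<phi> f \<le> dual_norm C n \<phi> * n f"
proof (cases "n f = 0")
  case True
  then show ?thesis using M(2)[OF f] by simp
next
  case False
  then have pos: "n f > 0" using gauge_nonneg[OF f] by simp
  let ?g = "(1 / n f) *\<^sub>R f"
  have g: "?g \<in> C" "n ?g \<le> 1"
    using scale_mem[OF f, of "1 / n f"] gauge_scale_le[OF f, of "1 / n f"] pos by auto
  have "\<phi> ?g \<le> dual_norm C n \<phi>"
    unfolding dual_norm_def by (intro cSUP_upper bdd_above_unit_ball[OF M]) (use g in auto)
  then show ?thesis using hom[OF f, of "1 / n f"] pos by (simp add: field_simps)
qed

end

section \<open>Dual cones of asymmetric normed spaces\<close>

context asym_normed_space
begin

lemma zero_in: "0 \<in> E"
  using subspace by (rule subspace_0)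

lemma add_in: "\<lbrakk>x \<in> E; y \<in> E\<rbrakk> \<Longrightarrow> x + y \<in> E"
  using subspace by (rule subspace_add)

lemma diff_in: "\<lbrakk>x \<in> E; y \<in> E\<rbrakk> \<Longrightarrow> x - y \<in> E"
  using subspace by (rule subspace_diff)

lemma minus_in: "x \<in> E \<Longrightarrow> - x \<in> E"
  using subspace by (rule subspace_neg)

lemma scale_in: "x \<in> E \<Longrightarrow> r *\<^sub>R x \<in> E"
  using subspace by (rule subspace_scale)

lemma norm_zero: "p 0 = 0"
  using separation zero_in by blast

lemma norm_scale: "\<lbrakk>x \<in> E; r \<ge> 0\<rbrakk> \<Longrightarrow> p (r *\<^sub>R x) = r * p x"
  using homogeneous norm_zero by (cases "r = 0") auto

sublocale gauge_cone E p
  by standard (auto simp: zero_in norm_zero nonneg scale_in norm_scale)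

lemma ball_in_asym_topology:
  assumes "x \<in> E" "r > 0"
  shows "openin (asym_topology E p) {y \<in> E. p (y - x) < r}"
  unfolding asym_topology_def by (rule topology_generated_by_Basis) (use assms in blast)

lemma topspace_asym_topology: "topspace (asym_topology E p) = E"
proof -
  have "x \<in> {y \<in> E. p (y - x) < 1}" if "x \<in> E" for x
    using that norm_zero by simp
  then have "E \<subseteq> \<Union> {{y \<in> E. p (y - x) < r} | x r. x \<in> E \<and> r > 0}"
    using zero_less_one by blast
  then show ?thesis
    unfolding asym_topology_def topology_generated_by_topspace by blast
qed

text \<open>
  The balls form a base although they generate the topology only as a subbase: by the triangle
  inequality, a ball contains a smaller ball centred at any of its points.
\<close>

lemma openin_asym_topology_contains_ball:
  assumes "openin (asym_topology E p) U" "x \<in> U"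
  shows "\<exists>r>0. {y \<in> E. p (y - x) < r} \<subseteq> U"
proof -
  have "generate_topology_on {{y \<in> E. p (y - x) < r} | x r. x \<in> E \<and> r > 0} U"
    using assms(1) by (simp add: asym_topology_def openin_topology_generated_by_iff)
  then show ?thesis using assms(2)
  proof (induction arbitrary: x rule: generate_topology_on.induct)
    case Empty
    then show ?case by simp
  next
    case (Int A B)
    then obtain r s where "r > 0" "{y \<in> E. p (y - x) < r} \<subseteq> A"
      and "s > 0" "{y \<in> E. p (y - x) < s} \<subseteq> B" by (meson IntE)
    then show ?case by (intro exI[of _ "min r s"]) auto
  next
    case (UN K)
    then show ?case by (meson Sup_upper UnionE subset_trans)
  next
    case (Basis S)
    then obtain c s where S: "S = {y \<in> E. p (y - c) < s}" "c \<in> E" by blast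
    have x: "x \<in> E" "p (x - c) < s" using Basis(2) S by auto
    have "p (y - c) < s" if "y \<in> E" "p (y - x) < s - p (x - c)" for y
      using subadditive[OF diff_in[OF that(1) x(1)] diff_in[OF x(1) S(2)]] that(2) by simp
    then show ?case using x S by (intro exI[of _ "s - p (x - c)"]) auto
  qed
qed

text \<open>
  Upper semicontinuity at the origin already bounds \<open>\<phi>\<close> by \<open>1\<close> on some ball of radius \<open>r\<close>; scaling
  turns this into the constant \<open>2 / r\<close>, the factor \<open>2\<close> keeping the scaled vector strictly inside
  the ball.
\<close>

lemma dual_cone_iff_bounded:
  "\<phi> \<in> dual_cone E p \<longleftrightarrow>
     (\<forall>x. x \<notin> E \<longrightarrow> \<phi> x = 0) \<and>
     (\<forall>x\<in>E. \<forall>y\<in>E. \<phi> (x + y) = \<phi> x + \<phi> y) \<and>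
     (\<forall>x\<in>E. \<forall>r. \<phi> (r *\<^sub>R x) = r * \<phi> x) \<and>
     (\<exists>M\<ge>0. \<forall>x\<in>E. \<phi> x \<le> M * p x)"
proof -
  have "upper_semicontinuous_map (asym_topology E p) \<phi> \<longleftrightarrow> (\<exists>M\<ge>0. \<forall>x\<in>E. \<phi> x \<le> M * p x)"
    if add: "\<And>x y. \<lbrakk>x \<in> E; y \<in> E\<rbrakk> \<Longrightarrow> \<phi> (x + y) = \<phi> x + \<phi> y"
      and scale: "\<And>x r. x \<in> E \<Longrightarrow> \<phi> (r *\<^sub>R x) = r * \<phi> x"
  proof
    assume "upper_semicontinuous_map (asym_topology E p) \<phi>"
    then have "openin (asym_topology E p) {x \<in> E. \<phi> x < 1}" (is "openin _ ?U")
      by (simp add: upper_semicontinuous_map_def topspace_asym_topology)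
    moreover have "0 \<in> ?U"
      using zero_in scale[OF zero_in, of 0] by simp
    ultimately have "\<exists>r>0. {y \<in> E. p (y - 0) < r} \<subseteq> ?U"
      by (rule openin_asym_topology_contains_ball)
    then obtain r where "r > 0" and r: "{y \<in> E. p (y - 0) < r} \<subseteq> ?U"
      by blast
    have small: "t * \<phi> x < 1" if "x \<in> E" "t \<ge> 0" "t * p x < r" for t x
      using r scale_in[OF that(1), of t] norm_scale[OF that(1,2)] scale[OF that(1), of t] that(3)
      by auto
    have "\<phi> x \<le> 2 / r * p x" if x: "x \<in> E" for x
    proof (cases "p x = 0")
      case True
      have "\<phi> x \<le> 0"
      proof (rule ccontr)
        assume "\<not> \<phi> x \<le> 0"
        then show False using small[OF x, of "1 / \<phi> x"] True \<open>r > 0\<close> by simp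
      qed
      then show ?thesis using True by simp
    next
      case False
      then have "p x > 0" using nonneg[OF x] by simp
      then show ?thesis
        using small[OF x, of "r / (2 * p x)"] \<open>r > 0\<close> by (simp add: field_simps)
    qed
    then show "\<exists>M\<ge>0. \<forall>x\<in>E. \<phi> x \<le> M * p x"
      using \<open>r > 0\<close> by (intro exI[of _ "2 / r"]) auto
  next
    assume "\<exists>M\<ge>0. \<forall>x\<in>E. \<phi> x \<le> M * p x"
    then obtain M where M: "M \<ge> 0" "\<And>x. x \<in> E \<Longrightarrow> \<phi> x \<le> M * p x" by blast
    have "openin (asym_topology E p) {x \<in> E. \<phi> x < c}" for c
    proof (subst openin_subopen, intro ballI)
      fix x assume "x \<in> {x \<in> E. \<phi> x < c}"
      then have x: "x \<in> E" "\<phi> x < c" by auto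
      \<comment> \<open>dividing by \<open>M + 1\<close> rather than \<open>M\<close> covers \<open>M = 0\<close>\<close>
      define r where "r = (c - \<phi> x) / (M + 1)"
      have r: "r > 0" using x M by (simp add: r_def)
      have "\<phi> y < c" if y: "y \<in> E" "p (y - x) < r" for y
      proof -
        have "\<phi> y = \<phi> x + \<phi> (y - x)" using add[OF x(1) diff_in[OF y(1) x(1)]] by simp
        also have "\<dots> \<le> \<phi> x + M * p (y - x)" using M(2)[OF diff_in[OF y(1) x(1)]] by simp
        also have "\<dots> \<le> \<phi> x + M * r" using y M by (intro add_left_mono mult_left_mono) auto
        also have "\<dots> < \<phi> x + (M + 1) * r" using r by (simp add: algebra_simps)
        also have "\<dots> = c" using M by (simp add: r_def)
        finally show ?thesis .
      qed
      then have "{y \<in> E. p (y - x) < r} \<subseteq> {x \<in> E. \<phi> x < c}" by auto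
      moreover have "x \<in> {y \<in> E. p (y - x) < r}" using x r norm_zero by simp
      ultimately show "\<exists>T. openin (asym_topology E p) T \<and> x \<in> T \<and> T \<subseteq> {x \<in> E. \<phi> x < c}"
        using ball_in_asym_topology[OF x(1) r] by blast
    qed
    then show "upper_semicontinuous_map (asym_topology E p) \<phi>"
      by (simp add: upper_semicontinuous_map_def topspace_asym_topology)
  qed
  then show ?thesis unfolding dual_cone_def by blast
qed

lemma dual_coneD:
  assumes "\<phi> \<in> dual_cone E p"
  shows "x \<notin> E \<Longrightarrow> \<phi> x = 0"
    and "\<lbrakk>x \<in> E; y \<in> E\<rbrakk> \<Longrightarrow> \<phi> (x + y) = \<phi> x + \<phi> y"
    and "x \<in> E \<Longrightarrow> \<phi> (r *\<^sub>R x) = r * \<phi> x"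
    and "\<exists>M\<ge>0. \<forall>x\<in>E. \<phi> x \<le> M * p x"
  using assms unfolding dual_cone_iff_bounded by blast+

lemma dual_cone_minus:
  assumes "\<phi> \<in> dual_cone E p" "x \<in> E"
  shows "\<phi> (- x) = - \<phi> x"
  using dual_coneD(3)[OF assms, of "-1"] by simp

lemma dual_cone_diff:
  assumes "\<phi> \<in> dual_cone E p" "x \<in> E" "y \<in> E"
  shows "\<phi> (x - y) = \<phi> x - \<phi> y"
  using dual_coneD(2)[OF assms(1,2) minus_in[OF assms(3)]] dual_cone_minus[OF assms(1,3)] by simp

lemma dual_cone_add:
  assumes \<phi>: "\<phi> \<in> dual_cone E p" and \<psi>: "\<psi> \<in> dual_cone E p"
  shows "\<phi> + \<psi> \<in> dual_cone E p"
proof -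
  obtain M N where M: "M \<ge> 0" "\<And>x. x \<in> E \<Longrightarrow> \<phi> x \<le> M * p x"
    and N: "N \<ge> 0" "\<And>x. x \<in> E \<Longrightarrow> \<psi> x \<le> N * p x"
    using dual_coneD(4)[OF \<phi>] dual_coneD(4)[OF \<psi>] by blast
  have "\<phi> x + \<psi> x \<le> (M + N) * p x" if "x \<in> E" for x
    using M(2)[OF that] N(2)[OF that] by (simp add: distrib_right)
  then have "\<exists>K\<ge>0. \<forall>x\<in>E. (\<phi> + \<psi>) x \<le> K * p x"
    using M(1) N(1) by (intro exI[of _ "M + N"]) auto
  then show ?thesis
    using dual_coneD(1-3)[OF \<phi>] dual_coneD(1-3)[OF \<psi>]
    by (simp add: dual_cone_iff_bounded algebra_simps)
qed

lemma dual_cone_le_dual_norm: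
  assumes "\<phi> \<in> dual_cone E p" "x \<in> E"
  shows "\<phi> x \<le> dual_norm E p \<phi> * p x"
  using dual_coneD(4)[OF assms(1)] le_dual_norm_mult[of _ \<phi>, OF _ _ _ assms(2)]
    dual_coneD(3)[OF assms(1)] by metis

lemma dual_norm_dual_cone_nonneg:
  assumes "\<phi> \<in> dual_cone E p"
  shows "0 \<le> dual_norm E p \<phi>"
  using dual_coneD(4)[OF assms] dual_norm_nonneg[of _ \<phi>] dual_coneD(3)[OF assms zero_in, of 0]
  by auto

section \<open>Dense subspaces\<close>

lemma approximate_from_dense:
  assumes "Metric_space.mtopology E (sym_dist E p) closure_of D = E" "D \<subseteq> E" "z \<in> E" "e > 0"
  shows "\<exists>u\<in>D. p (z - u) + p (u - z) < e"
proof -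
  interpret M: Metric_space E "sym_dist E p" by (rule Metric_space_sym_dist)
  have "z \<in> M.mtopology closure_of D" using assms by simp
  then obtain u where u: "u \<in> D" "u \<in> M.mball z e"
    using assms(4) unfolding M.metric_closure_of by blast
  then have "p (z - u) + p (u - z) < e"
    using assms by (auto simp: sym_dist_def)
  with u show ?thesis by blast
qed

text \<open>
  A one-sided bound suffices for continuity in the symmetrized norm, because it may be applied to
  both \<open>z - u\<close> and \<open>u - z\<close>.
\<close>

lemma dual_cone_eqI_dense:
  assumes \<phi>: "\<phi> \<in> dual_cone E p" and \<psi>: "\<psi> \<in> dual_cone E p"
    and D: "D \<subseteq> E" "\<And>z e. \<lbrakk>z \<in> E; e > 0\<rbrakk> \<Longrightarrow> \<exists>u\<in>D. p (z - u) + p (u - z) < e"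
    and eq: "\<And>u. u \<in> D \<Longrightarrow> \<phi> u = \<psi> u"
  shows "\<phi> = \<psi>"
proof -
  \<comment> \<open>one inequality for arbitrary pairs suffices, by exchanging the functionals\<close>
  have le: "\<phi> z \<le> \<psi> z"
    if \<phi>: "\<phi> \<in> dual_cone E p" and \<psi>: "\<psi> \<in> dual_cone E p"
      and eq: "\<And>u. u \<in> D \<Longrightarrow> \<phi> u = \<psi> u" and z: "z \<in> E" for \<phi> \<psi> z
  proof (rule field_le_epsilon)
    fix e :: real assume e: "e > 0"
    define A where "A = dual_norm E p \<phi> + dual_norm E p \<psi>"
    have A: "A \<ge> 0"
      using dual_norm_dual_cone_nonneg[OF \<phi>] dual_norm_dual_cone_nonneg[OF \<psi>] by (simp add: A_def)
    then obtain u where u: "u \<in> D" "p (z - u) + p (u - z) < e / (A + 1)"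
      using D(2)[OF z, of "e / (A + 1)"] e by auto
    have uE: "u \<in> E" using u D by blast
    note zu = diff_in[OF z uE] and uz = diff_in[OF uE z]
    have "\<phi> z - \<psi> z = \<phi> (z - u) + \<psi> (u - z)"
      using eq[OF u(1)] dual_cone_diff[OF \<phi> z uE] dual_cone_diff[OF \<psi> uE z] by simp
    also have "\<dots> \<le> dual_norm E p \<phi> * p (z - u) + dual_norm E p \<psi> * p (u - z)"
      using dual_cone_le_dual_norm[OF \<phi> zu] dual_cone_le_dual_norm[OF \<psi> uz] by simp
    also have "\<dots> \<le> A * p (z - u) + A * p (u - z)"
      using dual_norm_dual_cone_nonneg[OF \<phi>] dual_norm_dual_cone_nonneg[OF \<psi>]
        nonneg[OF zu] nonneg[OF uz] by (intro add_mono mult_right_mono) (auto simp: A_def)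
    also have "\<dots> \<le> (A + 1) * (e / (A + 1))"
      unfolding distrib_left[symmetric]
      using u(2) A nonneg[OF zu] nonneg[OF uz] by (intro mult_mono) auto
    also have "\<dots> = e" using A by simp
    finally show "\<phi> z \<le> \<psi> z + e" by simp
  qed
  show ?thesis
  proof
    fix z show "\<phi> z = \<psi> z"
      using le[OF \<phi> \<psi> eq] le[OF \<psi> \<phi> eq[symmetric]] dual_coneD(1)[OF \<phi>] dual_coneD(1)[OF \<psi>]
      by (cases "z \<in> E") (auto intro: antisym)
  qed
qed

text \<open>
  The extension is the McShane formula \<open>h z = (INF u\<in>D. g u + M * p (z - u))\<close>, the largest
  extension of \<open>g\<close> that increases by at most \<open>M\<close> times the asymmetric distance. It is sublinear
  over any subspace \<open>D\<close>. Density makes it linear: if \<open>u\<close> approximates \<open>z\<close>, then using \<open>u\<close> for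
  \<open>h z\<close> and \<open>- u\<close> for \<open>h (- z)\<close> gives \<open>h z + h (- z) \<le> M * (p (z - u) + p (u - z))\<close>.
\<close>

lemma extend_from_dense_subspace:
  assumes D: "real_vector.subspace D" "D \<subseteq> E"
    and dense: "\<And>z e. \<lbrakk>z \<in> E; e > 0\<rbrakk> \<Longrightarrow> \<exists>u\<in>D. p (z - u) + p (u - z) < e"
    and g_add: "\<And>u v. \<lbrakk>u \<in> D; v \<in> D\<rbrakk> \<Longrightarrow> g (u + v) = g u + g v"
    and g_scale: "\<And>u r. u \<in> D \<Longrightarrow> g (r *\<^sub>R u) = r * g u"
    and M: "M \<ge> 0" and g_le: "\<And>u. u \<in> D \<Longrightarrow> g u \<le> M * p u"
  shows "\<exists>\<phi>\<in>dual_cone E p. (\<forall>u\<in>D. \<phi> u = g u) \<and> (\<forall>x\<in>E. \<phi> x \<le> M * p x)"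
proof -
  have DE: "u \<in> E" if "u \<in> D" for u using that D by blast
  have D_add: "u + v \<in> D" if "u \<in> D" "v \<in> D" for u v using D(1) that by (rule subspace_add)
  have D_scale: "r *\<^sub>R u \<in> D" if "u \<in> D" for u r using D(1) that by (rule subspace_scale)
  have D0: "0 \<in> D" using D(1) by (rule subspace_0)
  have D_neg: "- u \<in> D" if "u \<in> D" for u using D(1) that by (rule subspace_neg)
  have D_diff: "u - v \<in> D" if "u \<in> D" "v \<in> D" for u v using D(1) that by (rule subspace_diff)
  have g0: "g 0 = 0" using g_scale[OF D0, of 0] by simp
  have g_neg: "g (- u) = - g u" if "u \<in> D" for u using g_scale[OF that, of "-1"] by simp

  define h where "h z = (INF u\<in>D. g u + M * p (z - u))" for z
  have lower: "- (M * p (- z)) \<le> g u + M * p (z - u)" if z: "z \<in> E" and u: "u \<in> D" for z u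
  proof -
    have "p (- u) \<le> p (- z) + p (z - u)"
      using subadditive[OF minus_in[OF z] diff_in[OF z DE[OF u]]] by simp
    then have "M * p (- u) \<le> M * (p (- z) + p (z - u))" using M by (rule mult_left_mono)
    moreover have "- g u \<le> M * p (- u)"
      using g_le[OF D_neg[OF u]] g_neg[OF u] by simp
    ultimately show ?thesis by (simp add: distrib_left)
  qed
  have h_le: "h z \<le> g u + M * p (z - u)" if "z \<in> E" "u \<in> D" for z u
    unfolding h_def
    by (rule cINF_lower[OF bdd_belowI2[of _ "- (M * p (- z))"] that(2)]) (rule lower[OF that(1)])
  have h_ge: "c \<le> h z" if "\<And>u. u \<in> D \<Longrightarrow> c \<le> g u + M * p (z - u)" for z c
    unfolding h_def by (rule cINF_greatest) (use D0 that in auto)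

  have h_ext: "h u = g u" if u: "u \<in> D" for u
  proof (rule antisym)
    show "h u \<le> g u" using h_le[OF DE[OF u] u] norm_zero by simp
    show "g u \<le> h u"
    proof (rule h_ge)
      fix v assume v: "v \<in> D"
      then show "g u \<le> g v + M * p (u - v)"
        using g_add[OF v D_diff[OF u v]] g_le[OF D_diff[OF u v]] by simp
    qed
  qed
  have h_bound: "h z \<le> M * p z" if "z \<in> E" for z
    using h_le[OF that D0] g0 by simp
  have h_subadd: "h (z + w) \<le> h z + h w" if z: "z \<in> E" and w: "w \<in> E" for z w
  proof -
    have "h (z + w) - h w \<le> g u + M * p (z - u)" if u: "u \<in> D" for u
    proof -
      have "h (z + w) - (g u + M * p (z - u)) \<le> g v + M * p (w - v)" if v: "v \<in> D" for v
      proof -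
        have "p ((z + w) - (u + v)) \<le> p (z - u) + p (w - v)"
          using subadditive[OF diff_in[OF z DE[OF u]] diff_in[OF w DE[OF v]]]
          by (simp add: algebra_simps)
        then have "M * p ((z + w) - (u + v)) \<le> M * (p (z - u) + p (w - v))"
          using M by (rule mult_left_mono)
        then show ?thesis
          using h_le[OF add_in[OF z w] D_add[OF u v]] g_add[OF u v] by (simp add: distrib_left)
      qed
      then have "h (z + w) - (g u + M * p (z - u)) \<le> h w" by (rule h_ge)
      then show ?thesis by simp
    qed
    then have "h (z + w) - h w \<le> h z" by (rule h_ge)
    then show ?thesis by simp
  qed
  have h_neg: "h (- z) = - h z" if z: "z \<in> E" for z
  proof (rule antisym)
    show "- h z \<le> h (- z)"
      using h_subadd[OF z minus_in[OF z]] h_ext[OF D0] g0 by simp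
    have "h (- z) + h z \<le> 0 + e" if e: "e > 0" for e
    proof -
      obtain u where u: "u \<in> D" "p (z - u) + p (u - z) < e / (M + 1)"
        using dense[OF z, of "e / (M + 1)"] e M by auto
      note zu = nonneg[OF diff_in[OF z DE[OF u(1)]]] and uz = nonneg[OF diff_in[OF DE[OF u(1)] z]]
      have "h (- z) + h z \<le> M * (p (z - u) + p (u - z))"
        using h_le[OF z u(1)] h_le[OF minus_in[OF z] D_neg[OF u(1)]] g_neg[OF u(1)]
        by (simp add: distrib_left)
      also have "\<dots> \<le> (M + 1) * (e / (M + 1))"
        using u(2) M zu uz by (intro mult_mono) auto
      also have "\<dots> = e" using M by simp
      finally show ?thesis by simp
    qed
    then have "h (- z) + h z \<le> 0" by (rule field_le_epsilon)
    then show "h (- z) \<le> - h z" by simp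
  qed
  have h_add: "h (z + w) = h z + h w" if z: "z \<in> E" and w: "w \<in> E" for z w
    using h_subadd[OF z w] h_subadd[OF add_in[OF z w] minus_in[OF w]] h_neg[OF w] by simp
  have h_scale_le: "h (r *\<^sub>R z) \<le> r * h z" if z: "z \<in> E" and r: "r > 0" for z r
  proof -
    have "h (r *\<^sub>R z) / r \<le> g u + M * p (z - u)" if u: "u \<in> D" for u
      using h_le[OF scale_in[OF z] D_scale[OF u], of r r] g_scale[OF u, of r]
        homogeneous[OF diff_in[OF z DE[OF u]] r] r
      by (simp add: scaleR_diff_right field_simps)
    then have "h (r *\<^sub>R z) / r \<le> h z" by (rule h_ge)
    then show ?thesis using r by (simp add: field_simps)
  qed
  have h_scale_pos: "h (r *\<^sub>R z) = r * h z" if z: "z \<in> E" and r: "r > 0" for z r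
    using h_scale_le[OF z r] h_scale_le[OF minus_in[OF z] r] h_neg[OF z] h_neg[OF scale_in[OF z]]
    by simp
  have h_scale: "h (r *\<^sub>R z) = r * h z" if z: "z \<in> E" for z r
  proof (cases r "0 :: real" rule: linorder_cases)
    case less
    then show ?thesis
      using h_scale_pos[OF z, of "- r"] h_neg[OF scale_in[OF z], of "- r"] by simp
  next
    case equal
    then show ?thesis using h_ext[OF D0] g0 by simp
  next
    case greater
    then show ?thesis by (rule h_scale_pos[OF z])
  qed

  define \<phi> where "\<phi> z = (if z \<in> E then h z else 0)" for z
  have "\<exists>M\<ge>0. \<forall>x\<in>E. \<phi> x \<le> M * p x" using M h_bound by (auto simp: \<phi>_def)
  then have "\<phi> \<in> dual_cone E p"
    by (simp add: dual_cone_iff_bounded \<phi>_def add_in scale_in h_add h_scale)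
  then show ?thesis
    by (rule bexI[rotated]) (simp add: \<phi>_def DE h_ext h_bound)
qed

end

section \<open>Evaluation functionals\<close>

context quasi_metric_space
begin

lemma gauge_cone_SLip0: "gauge_cone (SLip0 X d x0) (slip_norm X d)"
  by standard (auto simp: SLip0_zero slip_norm_zero slip_norm_nonneg SLip0_scaleR)

lemma delta_eval: "f \<in> SLip0 X d x0 \<Longrightarrow> delta X d x0 x f = f x"
  by (simp add: delta_def)

lemma delta_base: "delta X d x0 x0 = 0"
  by (auto simp: delta_def SLip0_def fun_eq_iff)

lemma span_delta_homogeneous:
  assumes "v \<in> span (delta X d x0 ` X)" "f \<in> SLip0 X d x0" "r \<ge> 0"
  shows "v (r *\<^sub>R f) = r * v f"
  using assms(1)
proof (induction rule: span_induct_alt)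
  case base
  show ?case by simp
next
  case (step c a v)
  then obtain x where a: "a = delta X d x0 x" by auto
  have "a (r *\<^sub>R f) = r * a f"
    unfolding a delta_eval[OF SLip0_scaleR(1)[OF assms(2,3)]] delta_eval[OF assms(2)] by simp
  with step(2) show ?case
    unfolding plus_fun_apply scaleR_fun_apply by (simp only:) (simp add: algebra_simps)
qed

text \<open>
  This makes the supremum defining the dual norm of \<open>v\<close> a supremum of a set that is bounded above;
  an unbounded one would have a meaningless real value.
\<close>

lemma span_delta_bounded:
  assumes x0: "x0 \<in> X" and "v \<in> span (delta X d x0 ` X)"
  shows "\<exists>M\<ge>0. \<forall>f\<in>SLip0 X d x0. v f \<le> M * slip_norm X d f"
  using assms(2)
proof (induction rule: span_induct_alt)
  case base
  show ?case by (auto intro!: exI[of _ 0])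
next
  case (step c a v)
  then obtain x where x: "x \<in> X" "a = delta X d x0 x" by auto
  obtain M where M: "M \<ge> 0" "\<And>f. f \<in> SLip0 X d x0 \<Longrightarrow> v f \<le> M * slip_norm X d f"
    using step by blast
  \<comment> \<open>the sign of \<open>c\<close> is unknown, so \<open>f x\<close> has to be bounded on both sides\<close>
  define R where "R = d x0 x + d x x0"
  have R: "R \<ge> 0" using nonneg x x0 by (simp add: R_def)
  have "(c *\<^sub>R a + v) f \<le> (\<bar>c\<bar> * R + M) * slip_norm X d f" if f: "f \<in> SLip0 X d x0" for f
  proof -
    have "f x0 = 0" using f by (simp add: SLip0_def)
    moreover have "f x - f x0 \<le> slip_norm X d f * d x0 x" "f x0 - f x \<le> slip_norm X d f * d x x0"
      using slip_norm_bound[OF f] x x0 by auto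
    moreover have "slip_norm X d f * d x0 x \<ge> 0" "slip_norm X d f * d x x0 \<ge> 0"
      using nonneg x x0 slip_norm_nonneg[OF f] by auto
    ultimately have "\<bar>f x\<bar> \<le> R * slip_norm X d f" by (simp add: R_def algebra_simps abs_le_iff)
    then have "\<bar>c\<bar> * \<bar>f x\<bar> \<le> \<bar>c\<bar> * (R * slip_norm X d f)" by (intro mult_left_mono) auto
    moreover have "c * f x \<le> \<bar>c\<bar> * \<bar>f x\<bar>" by (simp add: abs_mult[symmetric])
    ultimately show ?thesis
      using M(2)[OF f] x f by (simp add: delta_eval algebra_simps)
  qed
  then show ?case
    using M(1) R by (intro exI[of _ "\<bar>c\<bar> * R + M"]) auto
qed

text \<open>
  Read for fixed \<open>f\<close> and varying \<open>v\<close>, this bounds the functional \<open>v \<mapsto> v f\<close> on the span by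
  the norm of \<open>f\<close>.
\<close>

lemma span_delta_le:
  assumes "x0 \<in> X" and v: "v \<in> span (delta X d x0 ` X)" and f: "f \<in> SLip0 X d x0"
  shows "v f \<le> dual_norm (SLip0 X d x0) (slip_norm X d) v * slip_norm X d f"
proof -
  interpret W: gauge_cone "SLip0 X d x0" "slip_norm X d" by (rule gauge_cone_SLip0)
  obtain M where M: "M \<ge> 0" "\<And>f. f \<in> SLip0 X d x0 \<Longrightarrow> v f \<le> M * slip_norm X d f"
    using span_delta_bounded[OF assms(1,2)] by blast
  show ?thesis
    by (rule W.le_dual_norm_mult[OF M]) (use span_delta_homogeneous[OF v] f in auto)
qed

text \<open>
  The order of the arguments of \<open>d\<close> matters: it matches the semi-Lipschitz inequality
  \<open>f x - f y \<le> L * d y x\<close>.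
\<close>

lemma dual_norm_delta_diff_le:
  assumes "x \<in> X" "y \<in> X"
  shows "dual_norm (SLip0 X d x0) (slip_norm X d) (delta X d x0 x - delta X d x0 y) \<le> d y x"
proof -
  interpret W: gauge_cone "SLip0 X d x0" "slip_norm X d" by (rule gauge_cone_SLip0)
  show ?thesis
  proof (rule W.dual_norm_le)
    show "0 \<le> d y x" using nonneg assms by blast
    show "(delta X d x0 x - delta X d x0 y) f \<le> d y x * slip_norm X d f"
      if "f \<in> SLip0 X d x0" for f
      using slip_norm_bound[OF that assms] that by (simp add: delta_eval mult.commute)
  qed
qed

end

section \<open>The dual of the free space\<close>

text \<open>
  The bijection matches the increments \<open>z\<close> with \<open>y = x + z\<close> with those between the images, so the two
  infima run over the same numbers, including the case where there are none.
\<close>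

lemma cone_isometric_isomorphismI:
  assumes bij: "bij_betw \<Phi> C D"
    and closed: "\<And>x y. \<lbrakk>x \<in> C; y \<in> C\<rbrakk> \<Longrightarrow> x + y \<in> C"
    and add: "\<And>x y. \<lbrakk>x \<in> C; y \<in> C\<rbrakk> \<Longrightarrow> \<Phi> (x + y) = \<Phi> x + \<Phi> y"
    and scale: "\<And>x r. \<lbrakk>x \<in> C; r \<ge> 0\<rbrakk> \<Longrightarrow> \<Phi> (r *\<^sub>R x) = r *\<^sub>R \<Phi> x"
    and norm: "\<And>x. x \<in> C \<Longrightarrow> n (\<Phi> x) = m x"
  shows "cone_isometric_isomorphism C m D n \<Phi>"
proof -
  have "cone_dist D n (\<Phi> x) (\<Phi> y) = cone_dist C m x y" if x: "x \<in> C" and y: "y \<in> C" for x y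
  proof -
    have "y = x + z \<longleftrightarrow> \<Phi> y = \<Phi> x + \<Phi> z" if "z \<in> C" for z
      using bij_betw_imp_inj_on[OF bij] y closed[OF x that] add[OF x that]
      by (metis inj_on_eq_iff)
    then have "{z \<in> D. \<Phi> y = \<Phi> x + z} = \<Phi> ` {z \<in> C. y = x + z}"
      unfolding bij_betw_imp_surj_on[OF bij, symmetric] by blast
    then have "cone_dist D n (\<Phi> x) (\<Phi> y) = (INF z\<in>{z \<in> C. y = x + z}. ereal (n (\<Phi> z)))"
      by (simp add: cone_dist_def image_image)
    also have "\<dots> = cone_dist C m x y"
      unfolding cone_dist_def by (intro INF_cong) (auto simp: norm)
    finally show ?thesis .
  qed
  with bij add scale show ?thesis unfolding cone_isometric_isomorphism_def by blast
qed

theorem theorem3p5: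
  fixes X :: "'a set" and d :: "'a \<Rightarrow> 'a \<Rightarrow> real" and x0 :: 'a
    and F :: "'e::real_vector set" and p :: "'e \<Rightarrow> real"
  assumes "quasi_metric_space X d"
    and "x0 \<in> X"
    and "is_semi_lipschitz_free_space X d x0 F p"
  shows "\<exists>\<Phi>. cone_isometric_isomorphism (dual_cone F p) (dual_norm F p)
                                         (SLip0 X d x0) (slip_norm X d) \<Phi>"
proof -
  interpret quasi_metric_space X d by (rule assms(1))
  define V where "V = span (delta X d x0 ` X)"
  define q where "q = dual_norm (SLip0 X d x0) (slip_norm X d)"
  obtain \<iota> where bc: "is_bicompletion V q F p \<iota>"
    using assms(3) unfolding is_semi_lipschitz_free_space_def V_def q_def by blast
  interpret F: asym_normed_space F p
    using bc by (simp add: is_bicompletion_def)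
  have \<iota>F: "\<iota> v \<in> F" if "v \<in> V" for v
    using bc that by (auto simp: is_bicompletion_def)
  have \<iota>_add: "\<iota> (v + w) = \<iota> v + \<iota> w" if "v \<in> V" "w \<in> V" for v w
    using bc that by (simp add: is_bicompletion_def)
  have \<iota>_scale: "\<iota> (r *\<^sub>R v) = r *\<^sub>R \<iota> v" if "v \<in> V" for v r
    using bc that by (simp add: is_bicompletion_def)
  have p\<iota>: "p (\<iota> v) = q v" if "v \<in> V" for v
    using bc that by (simp add: is_bicompletion_def)
  have V_add: "v + w \<in> V" if "v \<in> V" "w \<in> V" for v w
    using that unfolding V_def by (rule span_add)
  have V_scale: "r *\<^sub>R v \<in> V" if "v \<in> V" for v r
    using that unfolding V_def by (rule span_scale)
  have V_diff: "v - w \<in> V" if "v \<in> V" "w \<in> V" for v w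
    using that unfolding V_def by (rule span_diff)
  have V0: "0 \<in> V" unfolding V_def by (rule span_zero)
  have \<iota>0: "\<iota> 0 = 0" using \<iota>_scale[OF V0, of 0] by simp
  have \<iota>_diff: "\<iota> (v - w) = \<iota> v - \<iota> w" if "v \<in> V" "w \<in> V" for v w
    using \<iota>_add[OF V_diff[OF that] that(2)] by (simp add: algebra_simps)
  have \<delta>V: "delta X d x0 x \<in> V" if "x \<in> X" for x
    using that unfolding V_def by (intro span_base imageI)
  have subF: "\<iota> ` V \<subseteq> F" using \<iota>F by blast
  have denseF: "\<exists>u\<in>\<iota> ` V. p (z - u) + p (u - z) < e" if "z \<in> F" "e > 0" for z e
    using bc that by (intro F.approximate_from_dense) (auto simp: is_bicompletion_def)
  have subspace_image: "subspace (\<iota> ` V)"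
  proof (rule subspaceI)
    show "0 \<in> \<iota> ` V" using V0 \<iota>0 by (metis image_eqI)
    show "x + y \<in> \<iota> ` V" if "x \<in> \<iota> ` V" "y \<in> \<iota> ` V" for x y
      using that V_add by (auto simp: \<iota>_add[symmetric])
    show "c *\<^sub>R x \<in> \<iota> ` V" if "x \<in> \<iota> ` V" for c x
      using that V_scale by (auto simp: \<iota>_scale[symmetric])
  qed

  define \<Phi> where "\<Phi> \<phi> = (\<lambda>x. if x \<in> X then \<phi> (\<iota> (delta X d x0 x)) else 0)" for \<phi> :: "'e \<Rightarrow> real"

  have lip: "semi_lipschitz_with X d (dual_norm F p \<phi>) (\<Phi> \<phi>)" if \<phi>: "\<phi> \<in> dual_cone F p" for \<phi>
    unfolding semi_lipschitz_with_def
  proof (intro ballI)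
    fix x y assume xy: "x \<in> X" "y \<in> X"
    let ?v = "delta X d x0 x - delta X d x0 y"
    have v: "?v \<in> V" using xy by (intro V_diff \<delta>V)
    have "\<Phi> \<phi> x - \<Phi> \<phi> y = \<phi> (\<iota> ?v)"
      using xy by (simp add: \<Phi>_def \<iota>_diff \<delta>V \<iota>F F.dual_cone_diff[OF \<phi>])
    also have "\<dots> \<le> dual_norm F p \<phi> * q ?v"
      using F.dual_cone_le_dual_norm[OF \<phi> \<iota>F[OF v]] p\<iota>[OF v] by simp
    also have "\<dots> \<le> dual_norm F p \<phi> * d y x"
      unfolding q_def using F.dual_norm_dual_cone_nonneg[OF \<phi>]
      by (intro mult_left_mono dual_norm_delta_diff_le xy)
    finally show "\<Phi> \<phi> x - \<Phi> \<phi> y \<le> dual_norm F p \<phi> * d y x" .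
  qed
  have norm_le: "slip_norm X d (\<Phi> \<phi>) \<le> dual_norm F p \<phi>" if "\<phi> \<in> dual_cone F p" for \<phi>
    using F.dual_norm_dual_cone_nonneg[OF that] lip[OF that] by (rule slip_norm_le)
  have mem: "\<Phi> \<phi> \<in> SLip0 X d x0" if \<phi>: "\<phi> \<in> dual_cone F p" for \<phi>
  proof -
    \<comment> \<open>the constant must be positive, whereas \<open>dual_norm F p \<phi>\<close> may vanish\<close>
    have "semi_lipschitz_with X d (dual_norm F p \<phi> + 1) (\<Phi> \<phi>)"
      using lip[OF \<phi>] nonneg unfolding semi_lipschitz_with_def
      by (smt (verit) mult_right_mono)
    moreover have "dual_norm F p \<phi> + 1 > 0" using F.dual_norm_dual_cone_nonneg[OF \<phi>] by simp
    moreover have "\<Phi> \<phi> x0 = 0"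
      using F.dual_coneD(3)[OF \<phi> F.zero_in, of 0] by (simp add: \<Phi>_def delta_base \<iota>0)
    ultimately show ?thesis by (auto simp: SLip0_def \<Phi>_def)
  qed

  have inj: "\<phi> = \<psi>"
    if \<phi>: "\<phi> \<in> dual_cone F p" and \<psi>: "\<psi> \<in> dual_cone F p" and eq: "\<Phi> \<phi> = \<Phi> \<psi>" for \<phi> \<psi>
  proof (rule F.dual_cone_eqI_dense[OF \<phi> \<psi> subF denseF])
    fix u assume "u \<in> \<iota> ` V"
    then obtain v where v: "v \<in> V" "u = \<iota> v" by blast
    have "v \<in> V \<and> \<phi> (\<iota> v) = \<psi> (\<iota> v)"
      using v(1) unfolding V_def
    proof (induction rule: span_induct_alt)
      case base
      show ?case
        unfolding \<iota>0
        using F.dual_coneD(3)[OF \<phi> F.zero_in, of 0] F.dual_coneD(3)[OF \<psi> F.zero_in, of 0]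
        by (intro conjI span_zero) simp
    next
      case (step c a w)
      then obtain x where x: "x \<in> X" "a = delta X d x0 x" by auto
      have a: "a \<in> V" "\<phi> (\<iota> a) = \<psi> (\<iota> a)"
        using x \<delta>V fun_cong[OF eq, of x] by (auto simp: \<Phi>_def)
      have w: "w \<in> V" "\<phi> (\<iota> w) = \<psi> (\<iota> w)" using step by (auto simp: V_def)
      have "\<phi>' (\<iota> (c *\<^sub>R a + w)) = c * \<phi>' (\<iota> a) + \<phi>' (\<iota> w)" if "\<phi>' \<in> dual_cone F p" for \<phi>'
        using a(1) w(1) V_scale[OF a(1), of c]
        by (simp add: \<iota>_add \<iota>_scale \<iota>F F.scale_in F.dual_coneD(2,3)[OF that])
      from this[OF \<phi>] this[OF \<psi>] have "\<phi> (\<iota> (c *\<^sub>R a + w)) = \<psi> (\<iota> (c *\<^sub>R a + w))"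
        by (simp only: a w)
      then show ?case
        using V_add[OF V_scale[OF a(1)] w(1)] unfolding V_def by blast
    qed
    then show "\<phi> u = \<psi> u" using v by simp
  qed

  have extension: "\<exists>\<phi>\<in>dual_cone F p. \<Phi> \<phi> = f \<and> dual_norm F p \<phi> \<le> slip_norm X d f"
    if f: "f \<in> SLip0 X d x0" for f
  proof -
    have v_le: "v f \<le> slip_norm X d f * q v" if "v \<in> V" for v
      using span_delta_le[OF assms(2) that[unfolded V_def] f] by (simp add: q_def mult.commute)
    \<comment> \<open>\<open>v \<mapsto> v f\<close> factors through \<open>\<iota>\<close>, because \<open>\<iota>\<close> preserves the norms of \<open>v - w\<close> and \<open>w - v\<close>\<close>
    have le: "v f \<le> w f" if "v \<in> V" "w \<in> V" "\<iota> v = \<iota> w" for v w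
      using v_le[OF V_diff[OF that(1,2)]] p\<iota>[OF V_diff[OF that(1,2)]] \<iota>_diff[OF that(1,2)] that(3)
        F.norm_zero by simp
    define g where "g u = inv_into V \<iota> u f" for u
    have g\<iota>: "g (\<iota> v) = v f" if v: "v \<in> V" for v
    proof -
      have "inv_into V \<iota> (\<iota> v) \<in> V" "\<iota> (inv_into V \<iota> (\<iota> v)) = \<iota> v"
        using v by (simp_all add: inv_into_into f_inv_into_f)
      then show ?thesis unfolding g_def using v by (intro antisym le) auto
    qed
    have "\<exists>\<phi>\<in>dual_cone F p. (\<forall>u\<in>\<iota> ` V. \<phi> u = g u) \<and> (\<forall>x\<in>F. \<phi> x \<le> slip_norm X d f * p x)"
    proof (rule F.extend_from_dense_subspace[OF subspace_image subF denseF])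
      show "g (u + v) = g u + g v" if "u \<in> \<iota> ` V" "v \<in> \<iota> ` V" for u v
        using that by (auto simp: \<iota>_add[symmetric] g\<iota> V_add)
      show "g (r *\<^sub>R u) = r * g u" if "u \<in> \<iota> ` V" for u r
        using that by (auto simp: \<iota>_scale[symmetric] g\<iota> V_scale)
      show "0 \<le> slip_norm X d f" by (rule slip_norm_nonneg[OF f])
      show "g u \<le> slip_norm X d f * p u" if "u \<in> \<iota> ` V" for u
        using that v_le by (auto simp: g\<iota> p\<iota>)
    qed
    then obtain \<phi> where \<phi>: "\<phi> \<in> dual_cone F p" "\<And>u. u \<in> \<iota> ` V \<Longrightarrow> \<phi> u = g u"
      "\<And>x. x \<in> F \<Longrightarrow> \<phi> x \<le> slip_norm X d f * p x" by blast
    have "\<Phi> \<phi> x = f x" for x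
    proof (cases "x \<in> X")
      case True
      then show ?thesis using \<phi>(2) \<delta>V[OF True] f by (simp add: \<Phi>_def g\<iota> delta_eval)
    next
      case False
      then show ?thesis using f by (simp add: \<Phi>_def SLip0_def)
    qed
    moreover have "dual_norm F p \<phi> \<le> slip_norm X d f"
      using slip_norm_nonneg[OF f] \<phi>(3) by (rule F.dual_norm_le)
    ultimately show ?thesis using \<phi>(1) by blast
  qed

  have "cone_isometric_isomorphism (dual_cone F p) (dual_norm F p)
          (SLip0 X d x0) (slip_norm X d) \<Phi>"
  proof (rule cone_isometric_isomorphismI)
    show "bij_betw \<Phi> (dual_cone F p) (SLip0 X d x0)"
      unfolding bij_betw_def using inj mem extension by (blast intro: inj_onI)
    show "\<phi> + \<psi> \<in> dual_cone F p" if "\<phi> \<in> dual_cone F p" "\<psi> \<in> dual_cone F p" for \<phi> \<psi>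
      using that by (rule F.dual_cone_add)
    show "\<Phi> (\<phi> + \<psi>) = \<Phi> \<phi> + \<Phi> \<psi>" for \<phi> \<psi> by (auto simp: \<Phi>_def)
    show "\<Phi> (r *\<^sub>R \<phi>) = r *\<^sub>R \<Phi> \<phi>" for \<phi> r by (auto simp: \<Phi>_def)
    show "slip_norm X d (\<Phi> \<phi>) = dual_norm F p \<phi>" if \<phi>: "\<phi> \<in> dual_cone F p" for \<phi>
      using norm_le[OF \<phi>] extension[OF mem[OF \<phi>]] inj[OF _ \<phi>] by (metis antisym)
  qed
  then show ?thesis by blast
qed

end
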